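(* Consider a $(K,L,M_a,M_p,N)$-CW-MAP coded caching system with $0<M_aL+M_p<N$. Put $\gamma_a=\frac{KM_a}{N}$ and $\gamma_p=\frac{KM_p}{N}$, and assume that $\gamma_a$ is an integer with $0\le\gamma_a\le K$ and $\gamma_p$ is an integer with $0\le\gamma_p<\gamma_aL$. Then the triple $(M_a,M_p,R_{M_a,M_p})$ is achievable by a scheme with uncoded placement and subpacketization $F=K\binom{K-\gamma_aL}{\gamma_p}$, where $$R_{M_a,M_p}=\frac{(1+\gamma_p)\Big(\binom{K-\gamma_aL}{1+\gamma_p}+(K-1)\binom{K-\gamma_aL-1}{1+\gamma_p}-\sum_{i=1}^{\gamma_aL-1}\binom{K-\gamma_aL-1-(\gamma_aL-i)}{1+\gamma_p-(\gamma_aL-i)}\Big)-\gamma_pK\binom{K-\gamma_aL-2}{1+\gamma_p}-\eta\,\mathbf 1_{\{\gamma_p=\gamma_aL-1\}}}{K\binom{K-\gamma_aL}{\gamma_p}}$$ and $$\begin{aligned}\eta={}&(1+\gamma_p)\left(\Big(\tfrac{(K-2\gamma_aL)(K-2\gamma_aL+1)}{2}\Big)^{+}+\big((\gamma_aL-1)(K-2\gamma_aL-1)\big)^{+}\right)-\gamma_pK\,(K-2\gamma_aL-1)^{+}\\&+\gamma_p\left((1+\gamma_aL)(K-2\gamma_aL-1)+\tfrac{(K-2\gamma_aL-2)(K-2\gamma_aL-1)}{2}\right).\end{aligned}$$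
   Context: **Notation.** $a^+=\max(0,a)$; $\binom{n}{k}=0$ if $n<0$, $k<0$ or $n<k$; $\mathbf 1_{\{\cdot\}}$ is the indicator (equal to 1 if the condition holds and 0 otherwise). For an integer $a$, $\langle a\rangle_K$ denotes the representative of $a$ modulo $K$ in $\{1,\dots,K\}$. **The $(K,L,M_a,M_p,N)$-CW-MAP (cyclic wrap-around multi-access plus private) coded caching setting.** $K,L,N$ are positive integers with $1\le L\le K\le N$, and $M_a,M_p$ are real numbers in $[0,N]$. A server holds $N$ files $W_1,\dots,W_N$, each of $B$ bits. There are $K$ access caches, each of capacity $M_aB$ bits, and $K$ users, each with a private cache of capacity $M_pB$ bits. User $u\in\{1,\dots,K\}$ can read, at no cost, its own private cache and the $L$ access caches with indices $\langle u\rangle_K,\langle u+1\rangle_K,\dots,\langle u+L-1\rangle_K$. **Schemes.** A coded caching scheme with file size $B$ consists of: - placement: contents $\mathcal Z^a_k$ ($k\in\{1,\dots,K\}$) of the access caches and $\mathcal Z^p_u$ ($u\in\{1,\dots,K\}$) of the private caches, which are functions of the files $(W_1,\dots,W_N)$, of at most $M_aB$ and $M_pB$ bits respectively, chosen without knowledge of the demands; - delivery: for each demand vector $\mathbf d=(d_1,\dots,d_K)\in\{1,\dots,N\}^K$, a broadcast message $X_{\mathbf d}$ of $R_{\mathbf d}B$ bits, a function of the files, received without error by all users, such that each user $u$ can recover $W_{d_u}$ from $X_{\mathbf d}$, $\mathcal Z^p_u$ and the $L$ access caches it reads. The worst-case rate of the scheme is $R=\max_{\mathbf d}R_{\mathbf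 d}$. The triple $(M_a,M_p,R)$ is achievable if, for some large enough file size $B$, there is a coded caching scheme with worst-case rate $R$ for the memory pair $(M_a,M_p)$. The placement is uncoded if the caches store parts of the files copied without coding across parts; the scheme has subpacketization $F$ if each file is divided into $F$ equal-size parts (mini-subfiles), and the caches store such parts. *)

theory Defs
  imports Complex_Main "HOL-Library.FuncSet"
begin

text \<open>The representative of \<open>a\<close> modulo \<open>K\<close> in \<open>{1..K}\<close>.\<close>

definition wrap :: "nat \<Rightarrow> nat \<Rightarrow> nat" where
  "wrap K a = (if a mod K = 0 then K else a mod K)"

type_synonym bits = "bool list"
type_synonym files = "nat \<Rightarrow> bits"
type_synonym demand = "nat \<Rightarrow> nat"

definition libraries :: "nat \<Rightarrow> nat \<Rightarrow> files set" where
  "libraries N B = {1..N} \<rightarrow>\<^sub>E {w. length w = B}"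

definition demands :: "nat \<Rightarrow> nat \<Rightarrow> demand set" where
  "demands K N = {1..K} \<rightarrow>\<^sub>E {1..N}"

text \<open>\<open>msg_len S d\<close> is the number of bits of the broadcast message for the demand vector \<open>d\<close>.\<close>

record scheme =
  access_cache :: "nat \<Rightarrow> files \<Rightarrow> bits"
  private_cache :: "nat \<Rightarrow> files \<Rightarrow> bits"
  broadcast :: "demand \<Rightarrow> files \<Rightarrow> bits"
  msg_len :: "demand \<Rightarrow> nat"

text \<open>The number of stored (resp. broadcast) bits may not depend on the files: otherwise the length
  of a content would be a side channel that the capacity constraint does not account for.\<close>

definition fits :: "nat \<Rightarrow> nat \<Rightarrow> (files \<Rightarrow> bits) \<Rightarrow> real \<Rightarrow> bool" where
  "fits N B Z M \<longleftrightarrow> (\<exists>m::nat. real m \<le> M * real B \<and> (\<forall>W\<in>libraries N B. length (Z W) = m))"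

definition read_caches :: "nat \<Rightarrow> nat \<Rightarrow> scheme \<Rightarrow> nat \<Rightarrow> files \<Rightarrow> bits list" where
  "read_caches K L S u W = map (\<lambda>j. access_cache S (wrap K (u + j)) W) [0..<L]"

definition cw_map_scheme ::
    "nat \<Rightarrow> nat \<Rightarrow> real \<Rightarrow> real \<Rightarrow> nat \<Rightarrow> nat \<Rightarrow> scheme \<Rightarrow> bool" where
  "cw_map_scheme K L Ma Mp N B S \<longleftrightarrow>
     (\<forall>k\<in>{1..K}. fits N B (access_cache S k) Ma) \<and>
     (\<forall>u\<in>{1..K}. fits N B (private_cache S u) Mp) \<and>
     (\<forall>d\<in>demands K N. \<forall>W\<in>libraries N B. length (broadcast S d W) = msg_len S d) \<and>
     (\<forall>d\<in>demands K N. \<forall>u\<in>{1..K}. \<exists>decode. \<forall>W\<in>libraries N B.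
        decode (broadcast S d W) (private_cache S u W) (read_caches K L S u W) = W (d u))"

definition worst_case_rate :: "nat \<Rightarrow> nat \<Rightarrow> nat \<Rightarrow> scheme \<Rightarrow> real" where
  "worst_case_rate K N B S = Max ((\<lambda>d. real (msg_len S d) / real B) ` demands K N)"

definition mini_subfile :: "nat \<Rightarrow> nat \<Rightarrow> files \<Rightarrow> nat \<times> nat \<Rightarrow> bits" where
  "mini_subfile B F W = (\<lambda>(n, j). take (B div F) (drop (j * (B div F)) (W n)))"

definition stores_parts :: "nat \<Rightarrow> nat \<Rightarrow> nat \<Rightarrow> (files \<Rightarrow> bits) \<Rightarrow> bool" where
  "stores_parts N B F Z \<longleftrightarrow>
     (\<exists>ps. set ps \<subseteq> {1..N} \<times> {..<F} \<and>
        (\<forall>W\<in>libraries N B. Z W = concat (map (mini_subfile B F W) ps)))"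

definition uncoded_placement :: "nat \<Rightarrow> nat \<Rightarrow> nat \<Rightarrow> nat \<Rightarrow> scheme \<Rightarrow> bool" where
  "uncoded_placement K N B F S \<longleftrightarrow>
     F dvd B \<and>
     (\<forall>k\<in>{1..K}. stores_parts N B F (access_cache S k)) \<and>
     (\<forall>u\<in>{1..K}. stores_parts N B F (private_cache S u))"

definition achievable_uncoded ::
    "nat \<Rightarrow> nat \<Rightarrow> real \<Rightarrow> real \<Rightarrow> nat \<Rightarrow> real \<Rightarrow> nat \<Rightarrow> bool" where
  "achievable_uncoded K L Ma Mp N R F \<longleftrightarrow>
     (\<exists>B>0. \<exists>S. cw_map_scheme K L Ma Mp N B S \<and> uncoded_placement K N B F S \<and>
        worst_case_rate K N B S = R)"

text \<open>The binomial coefficient on the integers, zero outside \<open>0 \<le> k \<le> n\<close>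
  (unlike \<open>gbinomial\<close>, also for negative \<open>n\<close>).\<close>

definition ibinom :: "int \<Rightarrow> int \<Rightarrow> nat" where
  "ibinom n k = (if n < 0 \<or> k < 0 \<or> n < k then 0 else nat n choose nat k)"

definition pos_part :: "real \<Rightarrow> real" where
  "pos_part a = max 0 a"

text \<open>In the next two definitions \<open>t\<close> stands for \<open>\<gamma>\<^sub>a L\<close>.\<close>

definition cw_map_eta :: "int \<Rightarrow> int \<Rightarrow> int \<Rightarrow> real" where
  "cw_map_eta K t \<gamma>p =
     (1 + real_of_int \<gamma>p) *
       (pos_part ((real_of_int K - 2 * real_of_int t) * (real_of_int K - 2 * real_of_int t + 1) / 2)
        + pos_part ((real_of_int t - 1) * (real_of_int K - 2 * real_of_int t - 1)))
     - real_of_int \<gamma>p * real_of_int K * pos_part (real_of_int K - 2 * real_of_int t - 1)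
     + real_of_int \<gamma>p *
       ((1 + real_of_int t) * (real_of_int K - 2 * real_of_int t - 1)
        + (real_of_int K - 2 * real_of_int t - 2) * (real_of_int K - 2 * real_of_int t - 1) / 2)"

definition cw_map_rate :: "int \<Rightarrow> int \<Rightarrow> int \<Rightarrow> real" where
  "cw_map_rate K t \<gamma>p =
     ((1 + real_of_int \<gamma>p) *
        (real (ibinom (K - t) (1 + \<gamma>p))
         + (real_of_int K - 1) * real (ibinom (K - t - 1) (1 + \<gamma>p))
         - (\<Sum>i\<in>{1..t - 1}. real (ibinom (K - t - 1 - (t - i)) (1 + \<gamma>p - (t - i)))))
      - real_of_int \<gamma>p * real_of_int K * real (ibinom (K - t - 2) (1 + \<gamma>p))
      - cw_map_eta K t \<gamma>p * of_bool (\<gamma>p = t - 1))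
     / (real_of_int K * real (ibinom (K - t) \<gamma>p))"

end

theory Submission
  imports Defs
begin

text \<open>Each file is split into \<open>K\<close> subfiles, subfile \<open>k\<close> being readable by \<open>t = \<gamma>\<^sub>a L\<close> cyclically
  consecutive users through the access caches, and each subfile into mini-subfiles indexed by the
  \<open>p\<close>-subsets (\<open>p = \<gamma>\<^sub>p\<close>) of the remaining \<open>m = K - t\<close> users, which store them privately. A set \<open>S\<close> of
  \<open>p + 1\<close> of these users is a clique for subfile \<open>k\<close>: one XOR serves all of \<open>S\<close>, which makes
  \<open>K (m choose (p + 1))\<close> transmissions. Cliques \<open>(k, S)\<close> and \<open>(k', S')\<close> can share a transmission if
  \<open>S\<close> can read subfile \<open>k'\<close> and \<open>S'\<close> can read subfile \<open>k\<close>. As \<open>p < t\<close>, runs of consecutive users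
  provide \<open>K\<close> such pairs if \<open>p < t - 1\<close> and \<open>K (m - t + 1) / 2\<close> if \<open>p = t - 1\<close>, and this brings the
  number of transmissions down to the claimed one or below; the message is padded to meet the rate
  exactly. If \<open>m = p + 1\<close>, it is enough to send \<open>m\<close> XORs of items with the same offset.\<close>

section \<open>Cyclic offsets\<close>

text \<open>For \<open>k \<le> K\<close> this is u - k modulo K; the summand \<open>K - k\<close>
  avoids truncated subtraction.\<close>

definition offset :: "nat \<Rightarrow> nat \<Rightarrow> nat \<Rightarrow> nat" where
  "offset K k u = (u + (K - k)) mod K"

lemma wrap_mod: "0 < K \<Longrightarrow> wrap K a mod K = a mod K"
  by (simp add: wrap_def)

lemma wrap_in: "0 < K \<Longrightarrow> wrap K a \<in> {1..K}"
  by (auto simp: wrap_def less_imp_le)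

lemma wrap_cong: "a mod K = b mod K \<Longrightarrow> wrap K a = wrap K b"
  by (simp add: wrap_def)

lemma wrap_id: "u \<in> {1..K} \<Longrightarrow> wrap K u = u"
  by (cases "u = K") (auto simp: wrap_def)

lemma offset_mod_left: "offset K k (a mod K) = offset K k a"
  by (simp add: offset_def mod_add_left_eq)

lemma offset_wrap: "0 < K \<Longrightarrow> offset K k (wrap K a) = offset K k a"
  by (metis offset_mod_left wrap_mod)

lemma offset_less: "0 < K \<Longrightarrow> offset K k u < K"
  by (simp add: offset_def)

lemma offset_add: "k < K \<Longrightarrow> r < K \<Longrightarrow> offset K k (k + r) = r"
  by (simp add: offset_def)

lemma add_offset_mod: "k \<le> K \<Longrightarrow> (k + offset K k u) mod K = u mod K"
  by (simp add: offset_def mod_add_right_eq)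

lemma wrap_add_offset: "k \<le> K \<Longrightarrow> u \<in> {1..K} \<Longrightarrow> wrap K (k + offset K k u) = u"
  by (metis add_offset_mod wrap_cong wrap_id)

lemma offset_unique:
  assumes "k < K" "r < K" "(k + r) mod K = u mod K"
  shows "offset K k u = r"
  by (metis assms offset_add offset_mod_left)

lemma offset_add_right:
  assumes "k < K" "offset K k u + j < K"
  shows "offset K k (u + j) = offset K k u + j"
proof (rule offset_unique[OF assms])
  show "(k + (offset K k u + j)) mod K = (u + j) mod K"
    by (metis add.assoc add_offset_mod assms(1) less_imp_le mod_add_left_eq)
qed

section \<open>From delivery plans to schemes\<close>

text \<open>A clique is a pair \<open>(k, S)\<close> of a subfile and a set of \<open>p + 1\<close> users that cannot read it, the
  users being given by their offset from \<open>k\<close>; the item \<open>(k, S, r)\<close> is the mini-subfile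
  \<open>(k, S - {r})\<close> of the file wanted by the user at offset \<open>r\<close>.\<close>

definition cliques :: "nat \<Rightarrow> nat \<Rightarrow> nat \<Rightarrow> (nat \<times> nat set) set" where
  "cliques K t p = {..<K} \<times> {S. S \<subseteq> {t..<K} \<and> card S = Suc p}"

definition clique_items :: "nat \<times> nat set \<Rightarrow> (nat \<times> nat set \<times> nat) set" where
  "clique_items = (\<lambda>(k, S). {(k, S, r) |r. r \<in> S})"

text \<open>First disjunct: access caches; second: private cache. \<open>T\<close> holds offsets
  from \<open>k\<close>, not user numbers.\<close>

definition knows :: "nat \<Rightarrow> nat \<Rightarrow> nat \<Rightarrow> nat \<Rightarrow> nat set \<Rightarrow> bool" where
  "knows K t u k T \<longleftrightarrow> offset K k u < t \<or> offset K k u \<in> T"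

text \<open>The items of \<open>X\<close> are XORed into one bit; user \<open>k + r\<close>, who
  wants \<open>(k, S, r)\<close>, has to cancel all the others.\<close>

definition decodable :: "nat \<Rightarrow> nat \<Rightarrow> (nat \<times> nat set \<times> nat) set \<Rightarrow> bool" where
  "decodable K t X \<longleftrightarrow> (\<forall>(k, S, r)\<in>X. \<forall>(k', S', r')\<in>X.
     (k, S, r) \<noteq> (k', S', r') \<longrightarrow> knows K t (k + r) k' (S' - {r'}))"

text \<open>A cover, not a partition: an item may occur in several XORs.\<close>

definition delivery_plan :: "nat \<Rightarrow> nat \<Rightarrow> nat \<Rightarrow> (nat \<times> nat set \<times> nat) set set \<Rightarrow> bool" where
  "delivery_plan K t p \<X> \<longleftrightarrow>
     finite \<X> \<and> \<Union>\<X> = \<Union>(clique_items ` cliques K t p) \<and> (\<forall>X\<in>\<X>. decodable K t X)"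

lemma knows_wrap: "0 < K \<Longrightarrow> knows K t (wrap K u) k T = knows K t u k T"
  by (simp add: knows_def offset_wrap)

section \<open>Decoding from observations\<close>

lemma decoder_exists:
  assumes "\<And>W W'. W \<in> A \<Longrightarrow> W' \<in> A \<Longrightarrow> f W = f W' \<Longrightarrow> g W = g W' \<Longrightarrow> h W = h W' \<Longrightarrow> x W = x W'"
  shows "\<exists>decode. \<forall>W\<in>A. decode (f W) (g W) (h W) = x W"
proof (intro exI ballI)
  fix W assume W: "W \<in> A"
  \<comment> \<open>The decoder evaluates \<open>x\<close> at an arbitrary library consistent with
    the three observations; all such libraries give the same value.\<close>
  let ?V = "SOME V. V \<in> A \<and> f V = f W \<and> g V = g W \<and> h V = h W"
  have "?V \<in> A \<and> f ?V = f W \<and> g ?V = g W \<and> h ?V = h W"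
    by (rule someI[where x = W]) (use W in auto)
  then show "(\<lambda>a b c. x (SOME V. V \<in> A \<and> f V = a \<and> g V = b \<and> h V = c)) (f W) (g W) (h W) = x W"
    using assms W by blast
qed

lemma parity_determines_last:
  assumes "finite X" "x \<in> X" "\<And>y. y \<in> X \<Longrightarrow> y \<noteq> x \<Longrightarrow> P y = Q y"
    and "odd (card {y\<in>X. P y}) = odd (card {y\<in>X. Q y})"
  shows "P x = Q x"
proof -
  have *: "odd (card {y\<in>X. R y}) = (R x \<noteq> odd (card {y\<in>X - {x}. R y}))" for R
  proof (cases "R x")
    case True
    then have "{y\<in>X. R y} = insert x {y\<in>X - {x}. R y}" using assms(2) by auto
    then show ?thesis using True assms(1) by simp
  next
    case False
    then have "{y\<in>X. R y} = {y\<in>X - {x}. R y}" by auto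
    then show ?thesis using False by simp
  qed
  have "{y\<in>X - {x}. P y} = {y\<in>X - {x}. Q y}" using assms(3) by auto
  then show ?thesis using *[of P] *[of Q] assms(4) by auto
qed

section \<open>Caches made of single bits\<close>

definition stored :: "nat \<Rightarrow> (nat \<times> nat) list \<Rightarrow> files \<Rightarrow> bits" where
  "stored F ps W = concat (map (mini_subfile F F W) ps)"

text \<open>The construction takes file size \<open>F\<close>, so a mini-subfile has
  \<open>F div F = 1\<close> bit and bit positions number the mini-subfiles.\<close>

lemma mini_subfile_bit:
  assumes "W \<in> libraries N F" "n \<in> {1..N}" "j < F"
  shows "mini_subfile F F W (n, j) = [W n ! j]"
proof -
  have "length (W n) = F" using assms by (auto simp: libraries_def PiE_def Pi_def)
  then show ?thesis using assms(3)
    by (simp add: mini_subfile_def take_Suc_conv_app_nth hd_drop_conv_nth take_Suc)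
qed

lemma stored_conv_map:
  assumes "W \<in> libraries N F" "set ps \<subseteq> {1..N} \<times> {..<F}"
  shows "stored F ps W = map (\<lambda>(n, j). W n ! j) ps"
  using assms(2)
proof (induction ps)
  case (Cons q ps)
  then show ?case using mini_subfile_bit[OF assms(1)] by (cases q) (auto simp: stored_def)
qed (simp add: stored_def)

lemma stored_eqD:
  assumes "W \<in> libraries N F" "W' \<in> libraries N F" "set ps \<subseteq> {1..N} \<times> {..<F}"
    and "stored F ps W = stored F ps W'" "(n, j) \<in> set ps"
  shows "W n ! j = W' n ! j"
  using assms(4,5) stored_conv_map[OF assms(1,3)] stored_conv_map[OF assms(2,3)] by auto

lemma fits_stored:
  assumes "set ps \<subseteq> {1..N} \<times> {..<F}" "real (length ps) \<le> M * real F"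
  shows "fits N F (stored F ps) M"
  unfolding fits_def using assms stored_conv_map by (intro exI[of _ "length ps"]) auto

text \<open>\<open>idx\<close> is an arbitrary numbering of the mini-subfiles \<open>(k, T)\<close>
  by bit positions; \<open>Ts\<close> lists the \<open>p\<close>-subsets so that cache contents can
  be built as lists.\<close>

locale cw_map_placement =
  fixes K L N a p :: nat and idx :: "nat \<times> nat set \<Rightarrow> nat" and Ts :: "nat set list"
  assumes L_pos: "1 \<le> L" and K_le_N: "K \<le> N" and tp_less: "a * L + p < K"
    and set_Ts: "set Ts = {T. T \<subseteq> {a * L..<K} \<and> card T = p}" and distinct_Ts: "distinct Ts"
    and bij_idx: "bij_betw idx ({..<K} \<times> set Ts) {..<K * ((K - a * L) choose p)}"
begin

definition "F = K * ((K - a * L) choose p)"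

text \<open>Subfile \<open>k\<close> lies in the access caches k + i L + L - 1 modulo K for
  \<open>i < a\<close>. Their spacing is \<open>L\<close>, so each user at offset below
  \<open>a * L\<close> from \<open>k\<close> reads one of them.\<close>

definition access_parts :: "nat \<Rightarrow> (nat \<times> nat) list" where
  "access_parts c = concat (map (\<lambda>n. concat (map (\<lambda>i.
     map (\<lambda>T. (n, idx (offset K (i * L + L - 1) c, T))) Ts) [0..<a])) [1..<Suc N])"

text \<open>User \<open>u\<close> has offset \<open>r\<close> from subfile u - r, so this collects
  all \<open>(k, T)\<close> for which the offset of \<open>u\<close> from \<open>k\<close> lies in
  \<open>T\<close>.\<close>

definition private_parts :: "nat \<Rightarrow> (nat \<times> nat) list" where
  "private_parts u = concat (map (\<lambda>n. concat (map (\<lambda>T.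
     map (\<lambda>r. (n, idx (offset K r u, T))) (sorted_list_of_set T)) Ts)) [1..<Suc N])"

definition item_bit :: "demand \<Rightarrow> files \<Rightarrow> nat \<times> nat set \<times> nat \<Rightarrow> bool" where
  "item_bit d W = (\<lambda>(k, S, r). W (d (wrap K (k + r))) ! idx (k, S - {r}))"

definition message :: "(nat \<times> nat set \<times> nat) set list \<Rightarrow> nat \<Rightarrow> demand \<Rightarrow> files \<Rightarrow> bits" where
  "message Xs D d W =
     map (\<lambda>X. odd (card {x\<in>X. item_bit d W x})) Xs @ replicate (D - length Xs) False"

definition plan_scheme :: "(nat \<times> nat set \<times> nat) set list \<Rightarrow> nat \<Rightarrow> scheme" where
  "plan_scheme Xs D = \<lparr> access_cache = (\<lambda>c. stored F (access_parts c)),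
     private_cache = (\<lambda>u. stored F (private_parts u)),
     broadcast = message Xs D, msg_len = (\<lambda>d. D) \<rparr>"

lemma K_pos: "0 < K" using tp_less by simp

lemma length_Ts: "length Ts = (K - a * L) choose p"
  using distinct_card[OF distinct_Ts] set_Ts n_subsets[of "{a * L..<K}" p] by simp

lemma F_pos: "0 < F"
  using tp_less by (simp add: F_def zero_less_binomial_iff)

lemma idx_less: "k < K \<Longrightarrow> T \<in> set Ts \<Longrightarrow> idx (k, T) < F"
  using bij_betwE[OF bij_idx] by (force simp: F_def)

lemma set_access_parts: "set (access_parts c) =
    (\<Union>n\<in>{1..N}. \<Union>i<a. (\<lambda>T. (n, idx (offset K (i * L + L - 1) c, T))) ` set Ts)"
  unfolding access_parts_def
  by (simp add: atLeastLessThanSuc_atLeastAtMost lessThan_atLeast0 del: upt_Suc)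

lemma set_private_parts: "set (private_parts u) =
    (\<Union>n\<in>{1..N}. \<Union>T\<in>set Ts. (\<lambda>r. (n, idx (offset K r u, T))) ` T)"
proof -
  have "finite T" if "T \<in> set Ts" for T
    using that set_Ts finite_subset[of T "{a * L..<K}"] by auto
  then show ?thesis
    unfolding private_parts_def
    by (simp add: atLeastLessThanSuc_atLeastAtMost del: upt_Suc)
qed

lemma parts_range: "set (access_parts c) \<subseteq> {1..N} \<times> {..<F}" "set (private_parts c) \<subseteq> {1..N} \<times> {..<F}"
  unfolding set_access_parts set_private_parts using idx_less offset_less[OF K_pos] by auto

lemma length_access_parts: "length (access_parts c) = N * (a * ((K - a * L) choose p))"
  unfolding access_parts_def by (simp add: length_concat comp_def sum_list_triv length_Ts del: upt_Suc)

lemma length_private_parts: "length (private_parts u) = N * (((K - a * L) choose p) * p)"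
proof -
  have "map (\<lambda>T. length (sorted_list_of_set T)) Ts = map (\<lambda>T. p) Ts"
    using set_Ts by (auto intro!: map_cong)
  then have "sum_list (map (\<lambda>T. length (sorted_list_of_set T)) Ts) = length Ts * p"
    by (simp only: sum_list_triv) simp
  then show ?thesis
    unfolding private_parts_def by (simp add: length_concat comp_def sum_list_triv length_Ts del: upt_Suc)
qed

lemma known_part:
  assumes "W \<in> libraries N F" "W' \<in> libraries N F" "u \<in> {1..K}"
    and priv: "stored F (private_parts u) W = stored F (private_parts u) W'"
    and acc: "\<And>j. j < L \<Longrightarrow> stored F (access_parts (wrap K (u + j))) W = stored F (access_parts (wrap K (u + j))) W'"
    and "k < K" "T \<in> set Ts" "n \<in> {1..N}" and kn: "knows K (a * L) u k T"
  shows "W n ! idx (k, T) = W' n ! idx (k, T)"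
proof -
  define r where "r = offset K k u"
  have r_less: "r < K" unfolding r_def by (rule offset_less[OF K_pos])
  \<comment> \<open>Offsets are differences: k = v - (v - k) modulo K. This brings \<open>k\<close>
    into the form used in the cache contents.\<close>
  have base: "k = offset K (offset K k v) v" for v
  proof (rule sym, rule offset_unique)
    show "(offset K k v + k) mod K = v mod K"
      using add_offset_mod[of k K v] \<open>k < K\<close> by (simp add: add.commute)
  qed (use \<open>k < K\<close> offset_less K_pos in auto)
  consider "r < a * L" | "r \<in> T" using kn by (auto simp: knows_def r_def)
  then show ?thesis
  proof cases
    case 1
    \<comment> \<open>\<open>r\<close> lies in the \<open>i\<close>-th block of \<open>L\<close>
      offsets; going \<open>j\<close> caches ahead leads to the end of that block, where subfile
      \<open>k\<close> is stored.\<close>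
    define i where "i = r div L"
    define j where "j = L - 1 - r mod L"
    have "i < a" using 1 L_pos by (simp add: i_def less_mult_imp_div_less)
    have "j < L" using L_pos by (simp add: j_def)
    have "r mod L < L" using L_pos by simp
    then have rj: "r + j = i * L + L - 1"
      using div_mult_mod_eq[of r L] unfolding i_def j_def by linarith
    have "i * L + L \<le> a * L" using mult_le_mono1[of "Suc i" a L] \<open>i < a\<close> by simp
    then have "r + j < K" using rj tp_less L_pos by linarith
    then have "offset K k (u + j) = i * L + L - 1"
      using offset_add_right[of k K u j] \<open>k < K\<close> rj by (simp add: r_def)
    then have "offset K k (wrap K (u + j)) = i * L + L - 1" by (simp add: offset_wrap K_pos)
    then have "(n, idx (k, T)) \<in> set (access_parts (wrap K (u + j)))"
      unfolding set_access_parts using \<open>i < a\<close> assms(7,8) base[of "wrap K (u + j)"]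
      by (intro UN_I[of n] UN_I[of i] image_eqI[of _ _ T]) auto
    then show ?thesis
      using stored_eqD[OF assms(1,2) parts_range(1) acc[OF \<open>j < L\<close>]] by blast
  next
    case 2
    then have "(n, idx (k, T)) \<in> set (private_parts u)"
      unfolding set_private_parts using assms(7,8) base[of u]
      by (intro UN_I[of n] UN_I[of T] image_eqI[of _ _ r]) (auto simp: r_def)
    then show ?thesis using stored_eqD[OF assms(1,2) parts_range(2) priv] by blast
  qed
qed

text \<open>Each bit of the wanted file is either cached at the user or the only unknown item of
  some XOR.\<close>

lemma decode_file:
  assumes plan: "delivery_plan K (a * L) p \<X>" and Xs: "set Xs = \<X>"
    and d: "d \<in> demands K N" and u: "u \<in> {1..K}"
    and W: "W \<in> libraries N F" "W' \<in> libraries N F"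
    and msg: "message Xs D d W = message Xs D d W'"
    and priv: "stored F (private_parts u) W = stored F (private_parts u) W'"
    and acc: "\<And>j. j < L \<Longrightarrow> stored F (access_parts (wrap K (u + j))) W = stored F (access_parts (wrap K (u + j))) W'"
  shows "W (d u) = W' (d u)"
proof (rule nth_equalityI)
  have dv: "d v \<in> {1..N}" if "v \<in> {1..K}" for v using d that by (auto simp: demands_def PiE_def Pi_def)
  have len: "length (W (d u)) = F" "length (W' (d u)) = F"
    using W dv[OF u] by (auto simp: libraries_def PiE_def Pi_def)
  then show "length (W (d u)) = length (W' (d u))" by simp
  fix j assume "j < length (W (d u))"
  then have "j \<in> idx ` ({..<K} \<times> set Ts)"
    using bij_betw_imp_surj_on[OF bij_idx] len by (simp add: F_def)
  then obtain k T where k: "k < K" and T: "T \<in> set Ts" and j: "j = idx (k, T)" by auto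
  note known = known_part[OF W u priv acc]
  show "W (d u) ! j = W' (d u) ! j"
  proof (cases "knows K (a * L) u k T")
    case True
    then show ?thesis using known[OF _ k T dv[OF u]] j by simp
  next
    case False
    define r where "r = offset K k u"
    \<comment> \<open>Adding the user to \<open>T\<close> gives a clique whose item at
      \<open>r\<close> is the missing mini-subfile, as \<open>S - {r} = T\<close>.\<close>
    define S where "S = insert r T"
    have T': "T \<subseteq> {a * L..<K}" "card T = p" "finite T"
      using T set_Ts finite_subset[of T "{a * L..<K}"] by auto
    have r: "a * L \<le> r" "r < K" "r \<notin> T"
      using False offset_less[OF K_pos] by (auto simp: knows_def r_def)
    have "(k, S) \<in> cliques K (a * L) p" using k r T' by (auto simp: cliques_def S_def)
    then have "(k, S, r) \<in> \<Union>\<X>"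
      using plan unfolding delivery_plan_def by (force simp: clique_items_def S_def)
    then obtain X where X: "X \<in> \<X>" "(k, S, r) \<in> X" by auto
    have Xsub: "X \<subseteq> \<Union>(clique_items ` cliques K (a * L) p)"
      using plan X unfolding delivery_plan_def by auto
    have Xform: "k' < K \<and> S' - {r'} \<in> set Ts" if "(k', S', r') \<in> X" for k' S' r'
    proof -
      have "k' < K" "S' \<subseteq> {a * L..<K}" "card S' = Suc p" "r' \<in> S'"
        using that Xsub by (auto simp: clique_items_def cliques_def)
      then show ?thesis using set_Ts by (auto simp: card_Diff_singleton)
    qed
    have fin: "finite X"
    proof (rule finite_subset[OF Xsub])
      have "finite (cliques K (a * L) p)"
        unfolding cliques_def by (intro finite_cartesian_product) auto
      moreover have "finite (clique_items c)" if "c \<in> cliques K (a * L) p" for c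
        using that finite_subset[of "snd c" "{a * L..<K}"]
        by (auto simp: clique_items_def cliques_def)
      ultimately show "finite (\<Union>(clique_items ` cliques K (a * L) p))" by blast
    qed
    have wu: "wrap K (k + r) = u" using wrap_add_offset[of k K u] k u by (simp add: r_def)
    have "odd (card {x\<in>X. item_bit d W x}) = odd (card {x\<in>X. item_bit d W' x})"
      using msg X(1) Xs unfolding message_def by auto
    moreover have "item_bit d W y = item_bit d W' y" if y: "y \<in> X" "y \<noteq> (k, S, r)" for y
    proof -
      obtain k' S' r' where y': "y = (k', S', r')" by (cases y)
      have "knows K (a * L) (k + r) k' (S' - {r'})"
        using plan X y unfolding delivery_plan_def decodable_def y' by fast
      then have "knows K (a * L) u k' (S' - {r'})" using knows_wrap[OF K_pos] wu by metis
      then show ?thesis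
        using known Xform y(1) dv[OF wrap_in[OF K_pos]] by (auto simp: item_bit_def y')
    qed
    ultimately have "item_bit d W (k, S, r) = item_bit d W' (k, S, r)"
      using parity_determines_last[OF fin X(2)] by blast
    then show ?thesis using r wu by (simp add: item_bit_def S_def j)
  qed
qed

lemma plan_achievable:
  assumes plan: "delivery_plan K (a * L) p \<X>" and D: "card \<X> \<le> D"
    and Ma: "real a * real N \<le> Ma * real K" and Mp: "real p * real N \<le> Mp * real K"
  shows "achievable_uncoded K L Ma Mp N (real D / real F) F"
proof -
  obtain Xs where Xs: "set Xs = \<X>" "distinct Xs"
    using finite_distinct_list[of \<X>] plan by (auto simp: delivery_plan_def)
  let ?S = "plan_scheme Xs D"
  let ?c = "real ((K - a * L) choose p)"
  have lenXs: "length Xs \<le> D" using Xs D distinct_card by fastforce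
  have fits_a: "fits N F (stored F (access_parts c)) Ma" for c
    using mult_right_mono[OF Ma, of ?c]
    by (intro fits_stored parts_range) (simp add: length_access_parts F_def mult_ac)
  have fits_p: "fits N F (stored F (private_parts c)) Mp" for c
    using mult_right_mono[OF Mp, of ?c]
    by (intro fits_stored parts_range) (simp add: length_private_parts F_def mult_ac)
  have "cw_map_scheme K L Ma Mp N F ?S"
    unfolding cw_map_scheme_def
  proof (intro conjI ballI)
    fix d u assume du: "d \<in> demands K N" "u \<in> {1..K}"
    show "\<exists>decode. \<forall>W\<in>libraries N F.
      decode (broadcast ?S d W) (private_cache ?S u W) (read_caches K L ?S u W) = W (d u)"
      by (rule decoder_exists, rule decode_file[OF plan Xs(1) du])
        (auto simp: plan_scheme_def read_caches_def)
  qed (use fits_a fits_p lenXs in \<open>auto simp: plan_scheme_def message_def\<close>)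
  moreover have "uncoded_placement K N F F ?S"
    unfolding uncoded_placement_def stores_parts_def
  proof (intro conjI ballI)
    fix c
    show "\<exists>ps. set ps \<subseteq> {1..N} \<times> {..<F} \<and> (\<forall>W\<in>libraries N F.
        access_cache ?S c W = concat (map (mini_subfile F F W) ps))"
      using parts_range(1) by (intro exI[of _ "access_parts c"]) (simp add: plan_scheme_def stored_def)
    show "\<exists>ps. set ps \<subseteq> {1..N} \<times> {..<F} \<and> (\<forall>W\<in>libraries N F.
        private_cache ?S c W = concat (map (mini_subfile F F W) ps))"
      using parts_range(2) by (intro exI[of _ "private_parts c"]) (simp add: plan_scheme_def stored_def)
  qed simp
  moreover have "worst_case_rate K N F ?S = real D / real F"
  proof -
    \<comment> \<open>A constant demand shows that \<open>Max\<close> ranges over a nonempty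
      set.\<close>
    have "(\<lambda>k\<in>{1..K}. 1) \<in> demands K N" using K_le_N K_pos by (auto simp: demands_def)
    then have "(\<lambda>d. real (msg_len ?S d) / real F) ` demands K N = {real D / real F}"
      by (auto simp: plan_scheme_def)
    then show ?thesis by (simp add: worst_case_rate_def)
  qed
  ultimately show ?thesis unfolding achievable_uncoded_def using F_pos by blast
qed

end

lemma achievable_by_plan:
  assumes "1 \<le> L" "K \<le> N" "a * L + p < K"
    and "delivery_plan K (a * L) p \<X>" "card \<X> \<le> D"
    and "real a * real N \<le> Ma * real K" "real p * real N \<le> Mp * real K"
    and "F = K * ((K - a * L) choose p)"
  shows "achievable_uncoded K L Ma Mp N (real D / real F) F"
proof -
  let ?T = "{T. T \<subseteq> {a * L..<K} \<and> card T = p}"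
  have fin: "finite ?T" by simp
  then obtain Ts where Ts: "set Ts = ?T" "distinct Ts" using finite_distinct_list[OF fin] by auto
  have "card ({..<K} \<times> set Ts) = card {..<F}"
    unfolding Ts(1) assms(8) using n_subsets[of "{a * L..<K}" p] by simp
  then obtain idx where "bij_betw idx ({..<K} \<times> set Ts) {..<F}"
    using finite_same_card_bij[of "{..<K} \<times> set Ts" "{..<F}"] by auto
  then interpret cw_map_placement K L N a p idx Ts
    using assms Ts by unfold_locales auto
  show ?thesis using plan_achievable[OF assms(4-7)] assms(8) by (simp add: F_def)
qed

section \<open>Merging cliques\<close>

text \<open>Every fibre of \<open>h\<close> over its image contains some \<open>x\<close> and the
  different point \<open>\<tau> x\<close>.\<close>

lemma card_image_involution:
  assumes "finite I" "\<And>x. x \<in> I \<Longrightarrow> \<tau> x \<in> I" "\<And>x. x \<in> I \<Longrightarrow> \<tau> x \<noteq> x"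
    and "\<And>x. x \<in> I \<Longrightarrow> h (\<tau> x) = h x"
  shows "2 * card (h ` I) \<le> card I"
proof -
  have "2 * card (h ` I) = (\<Sum>y\<in>h ` I. 2)" by simp
  also have "\<dots> \<le> (\<Sum>y\<in>h ` I. card {x\<in>I. h x = y})"
  proof (rule sum_mono)
    fix y assume "y \<in> h ` I"
    then obtain x where x: "x \<in> I" "y = h x" by auto
    then have "card {x, \<tau> x} \<le> card {x\<in>I. h x = y}"
      using assms by (intro card_mono) auto
    then show "2 \<le> card {x\<in>I. h x = y}" using assms(3)[OF x(1)] by (simp add: eq_commute)
  qed
  also have "\<dots> = card I" using sum.image_gen[OF assms(1), of "\<lambda>_. 1::nat" h] by simp
  finally show ?thesis .
qed

lemma decodableI:
  assumes "\<And>k S r k' S' r'. (k, S, r) \<in> X \<Longrightarrow> (k', S', r') \<in> X \<Longrightarrow> (k, S, r) \<noteq> (k', S', r') \<Longrightarrow>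
    knows K t (k + r) k' (S' - {r'})"
  shows "decodable K t X"
  unfolding decodable_def Ball_def split_paired_All prod.case by (intro allI impI assms)

lemma decodableD:
  assumes "decodable K t X" "(k, S, r) \<in> X" "(k', S', r') \<in> X" "(k, S, r) \<noteq> (k', S', r')"
  shows "knows K t (k + r) k' (S' - {r'})"
  using bspec[OF bspec[OF assms(1)[unfolded decodable_def] assms(2), unfolded prod.case] assms(3)] assms(4)
  by simp

lemma decodable_clique:
  assumes "c \<in> cliques K t p"
  shows "decodable K t (clique_items c)"
proof -
  obtain k S where c: "c = (k, S)" "k < K" "S \<subseteq> {t..<K}"
    using assms by (auto simp: cliques_def)
  then have "offset K k (k + r) = r" if "r \<in> S" for r
    using that by (intro offset_add) auto
  then show ?thesis by (auto simp: c decodable_def clique_items_def knows_def)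
qed

lemma decodable_Un:
  assumes X: "decodable K t X" and Y: "decodable K t Y"
    and XY: "\<And>k S r k' S' r'. (k, S, r) \<in> X \<Longrightarrow> (k', S', r') \<in> Y \<Longrightarrow>
           offset K k' (k + r) < t \<and> offset K k (k' + r') < t"
  shows "decodable K t (X \<union> Y)"
proof (rule decodableI)
  fix k S r k' S' r'
  assume *: "(k, S, r) \<in> X \<union> Y" "(k', S', r') \<in> X \<union> Y" "(k, S, r) \<noteq> (k', S', r')"
  then consider "(k, S, r) \<in> X" "(k', S', r') \<in> X" | "(k, S, r) \<in> Y" "(k', S', r') \<in> Y"
    | "(k, S, r) \<in> X" "(k', S', r') \<in> Y" | "(k, S, r) \<in> Y" "(k', S', r') \<in> X" by blast
  then show "knows K t (k + r) k' (S' - {r'})"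
  proof cases
    case 1
    then show ?thesis using decodableD[OF X] *(3) by blast
  next
    case 2
    then show ?thesis using decodableD[OF Y] *(3) by blast
  next
    case 3
    then show ?thesis using XY by (simp add: knows_def)
  next
    case 4
    then show ?thesis using XY by (simp add: knows_def)
  qed
qed

lemma card_cliques: "card (cliques K t p) = K * ((K - t) choose Suc p)"
  using n_subsets[of "{t..<K}" "Suc p"] by (simp add: cliques_def card_cartesian_product)

lemma finite_cliques: "finite (cliques K t p)"
  unfolding cliques_def by (intro finite_cartesian_product) auto

text \<open>The clique formed by \<open>p + 1\<close> consecutive users of subfile \<open>k\<close> can be sent together with
  such a clique of subfile \<open>k + \<delta>\<close> when the users of each clique can read the other subfile.\<close>

definition run :: "nat \<Rightarrow> nat \<Rightarrow> nat \<times> nat \<Rightarrow> nat \<times> nat set" where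
  "run t p = (\<lambda>(k, \<delta>). (k, {max t \<delta>..max t \<delta> + p}))"

text \<open>The same pair of subfiles seen from the other one, from which the first is
  \<open>K - \<delta>\<close> steps ahead.\<close>

definition partner :: "nat \<Rightarrow> nat \<times> nat \<Rightarrow> nat \<times> nat" where
  "partner K = (\<lambda>(k, \<delta>). ((k + \<delta>) mod K, K - \<delta>))"

lemma partner_partner: "k < K \<Longrightarrow> \<delta> \<le> K \<Longrightarrow> partner K (partner K (k, \<delta>)) = (k, \<delta>)"
  by (simp add: partner_def mod_add_left_eq)

text \<open>The subfile changes even if \<open>\<delta> = K - \<delta>\<close>.\<close>

lemma partner_neq: "k < K \<Longrightarrow> 0 < \<delta> \<Longrightarrow> \<delta> < K \<Longrightarrow> partner K (k, \<delta>) \<noteq> (k, \<delta>)"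
  by (cases "k + \<delta> < K") (auto simp: partner_def le_mod_geq not_less)

text \<open>From subfile k + \<delta> the user has offset \<open>r - \<delta>\<close>, at most
  \<open>max t \<delta> + p - \<delta>\<close>. This is below \<open>t\<close> by
  \<open>p < t\<close> if \<open>t \<le> \<delta>\<close>, and by \<open>p < \<delta>\<close>
  otherwise.\<close>

lemma run_known:
  assumes "k < K" "p < t" "p < \<delta>" "\<delta> + p < K" "t + p < K"
    and "(k, S, r) \<in> clique_items (run t p (k, \<delta>))"
    and "(k', S', r') \<in> clique_items (run t p (partner K (k, \<delta>)))"
  shows "offset K k' (k + r) < t"
proof -
  have r: "max t \<delta> \<le> r" "r \<le> max t \<delta> + p" and k': "k' = (k + \<delta>) mod K"
    using assms(6,7) by (auto simp: clique_items_def run_def partner_def)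
  have "offset K k' (k + r) = r - \<delta>"
    unfolding k'
  proof (rule offset_unique)
    have "k + \<delta> + (r - \<delta>) = k + r" using r by simp
    then show "((k + \<delta>) mod K + (r - \<delta>)) mod K = (k + r) mod K"
      by (metis mod_add_left_eq)
  qed (use r assms in auto)
  then show ?thesis using r assms by auto
qed

text \<open>Injectivity of \<open>max t\<close> makes the \<open>K * card \<Delta>\<close> runs
  distinct, and \<open>partner\<close> pairs them, so merging saves at least half their number. The
  count is doubled to avoid division.\<close>

lemma merged_plan:
  assumes pt: "p < t" and tp: "t + p < K"
    and range: "\<And>\<delta>. \<delta> \<in> \<Delta> \<Longrightarrow> p < \<delta> \<and> \<delta> + p < K"
    and sym: "\<And>\<delta>. \<delta> \<in> \<Delta> \<Longrightarrow> K - \<delta> \<in> \<Delta>" and inj: "inj_on (max t) \<Delta>"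
  shows "\<exists>\<X>. delivery_plan K t p \<X> \<and>
           2 * card \<X> + K * card \<Delta> \<le> 2 * (K * ((K - t) choose Suc p))"
proof -
  define I where "I = {..<K} \<times> \<Delta>"
  define h where "h x = clique_items (run t p x) \<union> clique_items (run t p (partner K x))" for x
  let ?M = "run t p ` I" and ?C = "cliques K t p"
  let ?X = "clique_items ` (?C - ?M) \<union> h ` I"
  have fin: "finite I" unfolding I_def
    using range finite_subset[of \<Delta> "{..K}"] by fastforce
  have partner_I: "partner K x \<in> I" if "x \<in> I" for x
    using that sym tp by (auto simp: I_def partner_def)
  have M_sub: "?M \<subseteq> ?C"
    using range tp by (fastforce simp: I_def run_def cliques_def)
  have "inj_on (run t p) I"
    using inj by (auto simp: inj_on_def I_def run_def)
  then have card_M: "card ?M = K * card \<Delta>"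
    by (simp add: card_image I_def card_cartesian_product)
  have partner2: "partner K (partner K x) = x" if "x \<in> I" for x
    using that range partner_partner by (fastforce simp: I_def)
  \<comment> \<open>Partners have the same union, so \<open>h\<close> takes at most half as many
    values as there are runs.\<close>
  have "2 * card (h ` I) \<le> card I"
  proof (rule card_image_involution[OF fin partner_I])
    show "partner K x \<noteq> x" if "x \<in> I" for x
      using that range partner_neq by (fastforce simp: I_def)
    show "h (partner K x) = h x" if "x \<in> I" for x
      using partner2[OF that] by (auto simp: h_def)
  qed
  then have card_h: "2 * card (h ` I) \<le> K * card \<Delta>"
    by (simp add: I_def card_cartesian_product)
  have "finite ?X" using fin finite_cliques by simp
  moreover have "\<Union>?X = \<Union>(clique_items ` ?C)"
  proof -
    have "\<Union>(h ` I) = \<Union>(clique_items ` ?M)"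
      using partner_I by (auto simp: h_def)
    then have "\<Union>?X = \<Union>(clique_items ` (?C - ?M)) \<union> \<Union>(clique_items ` ?M)" by simp
    also have "\<dots> = \<Union>(clique_items ` ((?C - ?M) \<union> ?M))" by (simp only: image_Un Union_Un_distrib)
    finally show ?thesis using M_sub by (simp add: Un_absorb2)
  qed
  moreover have "decodable K t X" if X: "X \<in> ?X" for X
  proof -
    consider c where "c \<in> ?C" "X = clique_items c" | x where "x \<in> I" "X = h x"
      using X by blast
    then show ?thesis
    proof cases
      case 1
      then show ?thesis by (simp add: decodable_clique)
    next
      case 2
      have known: "offset K k' (k + r) < t" if "y \<in> I" "(k, S, r) \<in> clique_items (run t p y)"
        "(k', S', r') \<in> clique_items (run t p (partner K y))" for y k S r k' S' r'
      proof -
        obtain k0 \<delta> where y: "y = (k0, \<delta>)" by (cases y)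
        then have "k0 = k" using that(2) by (auto simp: clique_items_def run_def)
        then show ?thesis
          using run_known[of k K p t \<delta> S r k' S' r'] that range tp pt by (auto simp: y I_def)
      qed
      show ?thesis
        unfolding 2 h_def
      proof (rule decodable_Un)
        show "decodable K t (clique_items (run t p x))"
          "decodable K t (clique_items (run t p (partner K x)))"
          using decodable_clique M_sub partner_I 2 by blast+
        fix k S r k' S' r'
        assume "(k, S, r) \<in> clique_items (run t p x)"
          "(k', S', r') \<in> clique_items (run t p (partner K x))"
        then show "offset K k' (k + r) < t \<and> offset K k (k' + r') < t"
          using known[OF 2(1)] known[OF partner_I[OF 2(1)]] by (simp add: partner2[OF 2(1)])
      qed
    qed
  qed
  ultimately have plan: "delivery_plan K t p ?X" by (simp add: delivery_plan_def)
  have "card (clique_items ` (?C - ?M)) \<le> card (?C - ?M)"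
    using finite_cliques by (intro card_image_le) auto
  also have "\<dots> = card ?C - K * card \<Delta>"
    using M_sub fin card_M by (simp add: card_Diff_subset)
  finally have "card (clique_items ` (?C - ?M)) \<le> card ?C - K * card \<Delta>" .
  moreover have "K * card \<Delta> \<le> card ?C"
    using card_mono[OF finite_cliques M_sub] card_M by simp
  moreover have "card ?X \<le> card (clique_items ` (?C - ?M)) + card (h ` I)"
    by (rule card_Un_le)
  ultimately have "2 * card ?X + K * card \<Delta> \<le> 2 * card ?C"
    using card_h by linarith
  then show ?thesis using plan card_cliques by metis
qed

text \<open>If \<open>K = t + p + 1\<close>, every mini-subfile is missing at exactly one user.\<close>

lemma single_clique_plan:
  assumes K: "K = t + p + 1"
  shows "\<exists>\<X>. delivery_plan K t p \<X> \<and> card \<X> \<le> Suc p"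
proof (intro exI conjI)
  let ?U = "{t..<K}"
  let ?X = "(\<lambda>r. {(k, ?U, r) |k. k < K}) ` ?U"
  have "S = ?U" if "S \<subseteq> ?U" "card S = Suc p" for S
    using that K by (intro card_subset_eq) auto
  then have "cliques K t p = {..<K} \<times> {?U}" using K by (auto simp: cliques_def)
  then have "\<Union>?X = \<Union>(clique_items ` cliques K t p)" by (auto simp: clique_items_def)
  moreover have "decodable K t X" if X: "X \<in> ?X" for X
  proof -
    obtain r where r: "t \<le> r" "r < K" "X = {(k, ?U, r) |k. k < K}" using X by auto
    \<comment> \<open>The offsets of one user from two subfiles differ, so the offset from
      \<open>k'\<close> is below \<open>t\<close> or in \<open>?U - {r}\<close>.\<close>
    have "offset K k' (k + r) \<noteq> r" if "k < K" "k' < K" "k \<noteq> k'" for k k'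
    proof
      assume "offset K k' (k + r) = r"
      then have "(k' + r) mod K = (k + r) mod K"
        using add_offset_mod[of k' K "k + r"] that by simp
      then show False
        using offset_unique[of r K k "k' + r"] offset_unique[of r K k' "k' + r"] that r
        by (simp add: add.commute)
    qed
    then have "knows K t (k + r) k' (?U - {r})" if "k < K" "k' < K" "k \<noteq> k'" for k k'
      using that offset_less[of K k' "k + r"] by (auto simp: knows_def)
    then show ?thesis using r by (auto simp: decodable_def)
  qed
  ultimately show "delivery_plan K t p ?X" by (simp add: delivery_plan_def)
  show "card ?X \<le> Suc p"
    using card_image_le[of ?U "\<lambda>r. {(k, ?U, r) |k. k < K}"] K by simp
qed

section \<open>Comparison with the claimed rate\<close>

text \<open>Absorption bounds \<open>n choose j\<close> by \<open>Suc j * (n choose Suc j)\<close>;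
  Pascal's rule adds one more copy of the latter binomial.\<close>

lemma binomial_Suc_le: "k \<le> n \<Longrightarrow> (Suc n choose k) \<le> Suc k * (n choose k)"
proof (cases k)
  case (Suc j)
  assume "k \<le> n"
  have "Suc j * (n choose Suc j) = (n - j) * (n choose j)"
    by (metis binomial_absorb_comp binomial_absorption diff_Suc_Suc)
  moreover have "1 * (n choose j) \<le> (n - j) * (n choose j)"
    using \<open>k \<le> n\<close> Suc by (intro mult_le_mono1) simp
  ultimately show ?thesis by (simp add: Suc)
qed simp

text \<open>With n = m - 2 and k = p this compares the clique count with the claimed one, up to one
  transmission per subfile. Equality holds at \<open>n = k\<close>, where the induction
  starts.\<close>

lemma binomial_Suc_le': "k \<le> n \<Longrightarrow> (Suc n choose k) \<le> k * (n choose k) + 1"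
proof (induction n rule: dec_induct)
  case (step n)
  show ?case
  proof (cases k)
    case (Suc j)
    have "(Suc n choose j) \<le> k * (n choose j)" using binomial_Suc_le[of j n] step Suc by simp
    then show ?thesis using step.IH by (simp add: Suc algebra_simps)
  qed simp
qed simp

section \<open>Closed forms of the claimed rate\<close>

lemma ibinom_of_nat: "ibinom (int n) (int k) = n choose k"
  by (simp add: ibinom_def)

text \<open>A hockey-stick sum, reindexed by j = t - 1 - i. If \<open>Suc p = t\<close>, the range
  stops just before the last nonzero term, j = p, whose value is 1.\<close>

lemma rate_sum:
  assumes "p < t" "p + 2 \<le> m"
  shows "(\<Sum>i\<in>{1..int t - 1}. real (ibinom (int m - 1 - (int t - i)) (1 + int p - (int t - i))))
    = real ((m - 1) choose p) - of_bool (Suc p = t)"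
proof -
  define f where "f j = real (ibinom (int m - 1 - int (Suc j)) (1 + int p - int (Suc j)))" for j
  have "(\<Sum>i\<in>{1..int t - 1}. real (ibinom (int m - 1 - (int t - i)) (1 + int p - (int t - i)))) =
      (\<Sum>j<t - 1. f j)"
    by (rule sum.reindex_bij_witness[where i = "\<lambda>j. int t - 1 - int j" and j = "\<lambda>i. nat (int t - 1 - i)"])
      (auto simp: f_def)
  also have "\<dots> = (\<Sum>j\<le>p. f j) - of_bool (Suc p = t) * f p"
  proof (cases "Suc p = t")
    case True
    then show ?thesis by (auto simp: lessThan_Suc_atMost[symmetric])
  next
    case False
    have "f j = 0" if "p < j" for j using that by (simp add: f_def ibinom_def)
    then have "(\<Sum>j<t - 1. f j) = (\<Sum>j\<le>p. f j)"
      using False assms by (intro sum.mono_neutral_right) auto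
    then show ?thesis using False by simp
  qed
  also have "(\<Sum>j\<le>p. f j) = (\<Sum>j\<le>p. real ((m - 2 - j) choose (p - j)))"
  proof (rule sum.cong[OF refl])
    fix j assume "j \<in> {..p}"
    then have "int m - 1 - int (Suc j) = int (m - 2 - j)" "1 + int p - int (Suc j) = int (p - j)"
      using assms by auto
    then show "f j = real ((m - 2 - j) choose (p - j))" unfolding f_def by (simp only: ibinom_of_nat)
  qed
  also have "\<dots> = real (Suc (m - 2) choose p)"
    using sum_choose_diagonal[of p "m - 2"] assms by (simp flip: of_nat_sum)
  also have "Suc (m - 2) = m - 1" using assms by simp
  also have "f p = 1"
  proof -
    have "int m - 1 - int (Suc p) = int (m - 2 - p)" "1 + int p - int (Suc p) = int 0"
      using assms by auto
    then show ?thesis unfolding f_def by (simp only: ibinom_of_nat binomial_n_0)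
  qed
  finally show ?thesis by simp
qed

lemma rate_single:
  assumes "K = t + p + 1" "p < t"
  shows "cw_map_rate (int K) (int t) (int p) =
    real (if Suc p = t then (p + 1)^2 else p + 1) / real (K * ((K - t) choose p))"
proof -
  \<comment> \<open>Each lower index exceeds its upper index by one.\<close>
  have "(\<Sum>i\<in>{1..int t - 1}. real (ibinom (int p - (int t - i)) (1 + int p - (int t - i)))) = 0"
    by (intro sum.neutral) (auto simp: ibinom_def)
  moreover have "ibinom (1 + int p) (1 + int p) = 1" "ibinom (int p) (1 + int p) = 0"
      "ibinom (int p - 1) (1 + int p) = 0" "ibinom (1 + int p) (int p) = Suc p"
    using ibinom_of_nat[of "Suc p" "Suc p"] ibinom_of_nat[of "Suc p" p]
    by (simp_all add: ibinom_def nat_add_distrib)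
  \<comment> \<open>Here K = 2 t, so all positive parts vanish and only the last summand of \<eta>
    is left.\<close>
  moreover have "cw_map_eta (int K) (int t) (int p) = - real p * (real p + 1)" if "Suc p = t"
    using that assms by (auto simp: cw_map_eta_def pos_part_def algebra_simps max_def)
  ultimately show ?thesis
    using assms by (auto simp: cw_map_rate_def power2_eq_square algebra_simps)
qed

text \<open>As K - 2 t = m - t is at least 1, all arguments of \<open>pos_part\<close> are
  nonnegative and a polynomial identity remains.\<close>

lemma eta_eq:
  assumes "K = t + m" "t = p + 1" "t < m"
  shows "cw_map_eta (int K) (int t) (int p) = (real m - real t) * (real m + real t - 1) / 2"
proof -
  obtain s where "m = t + Suc s" using assms(3) less_imp_Suc_add by auto
  then show ?thesis using assms
    by (simp add: cw_map_eta_def pos_part_def) (simp add: field_simps)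
qed

lemma rate_general:
  assumes K: "K = t + m" and pt: "p < t" and m: "p + 2 \<le> m"
  shows "cw_map_rate (int K) (int t) (int p) =
    real K * (real ((m - 1) choose Suc p) + real p * real ((m - 2) choose p)
      - of_bool (Suc p = t) * (real m - real t - 1) / 2) / real (K * ((K - t) choose p))"
proof -
  have Kt: "int K - int t = int m" using K by simp
  have "1 + int p = int (Suc p)" "int m - 1 = int (m - 1)" "int m - 2 = int (m - 2)"
    using m by auto
  then have bin: "ibinom (int m) (1 + int p) = m choose Suc p"
      "ibinom (int m - 1) (1 + int p) = (m - 1) choose Suc p"
      "ibinom (int m - 2) (1 + int p) = (m - 2) choose Suc p"
    by (simp_all only: ibinom_of_nat)
  obtain n where n: "m = Suc (Suc n)" using m by (metis add_2_eq_Suc le_Suc_ex add.commute add.left_commute)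
  \<comment> \<open>Pascal's rule turns the three binomials of \<open>bin\<close> into A + C, A and
    A - B. The hockey-stick sum cancels C, which leaves a multiple of K.\<close>
  define A where "A = real (Suc n choose Suc p)"
  define B where "B = real (n choose p)"
  define C where "C = real (Suc n choose p)"
  define E where "E = cw_map_eta (int K) (int t) (int p) * of_bool (int p = int t - 1)"
  have E: "E = of_bool (Suc p = t) * ((real m - real t) * (real m + real t - 1) / 2)"
    using eta_eq[OF K] m pt by (auto simp: E_def)
  have n2: "real (n choose Suc p) = A - B" by (simp add: A_def B_def)
  have m0: "real (m choose Suc p) = A + C" by (simp add: A_def C_def n)
  have "cw_map_rate (int K) (int t) (int p) =
    ((1 + real p) * (real (m choose Suc p) + (real K - 1) * real ((m - 1) choose Suc p)
      - (real ((m - 1) choose p) - of_bool (Suc p = t)))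
      - real p * real K * real ((m - 2) choose Suc p) - E) / real (K * ((K - t) choose p))"
    unfolding cw_map_rate_def Kt bin rate_sum[OF pt m] E_def using K by (simp add: ibinom_of_nat)
  also have "\<dots> = ((1 + real p) * (A + C + (real K - 1) * A - (C - of_bool (Suc p = t)))
      - real p * real K * (A - B) - E) / real (K * ((K - t) choose p))"
    unfolding m0 n2[symmetric] by (simp add: n A_def C_def)
  also have "(1 + real p) * (A + C + (real K - 1) * A - (C - of_bool (Suc p = t)))
      - real p * real K * (A - B) - E =
      real K * (A + real p * B - of_bool (Suc p = t) * (real m - real t - 1) / 2)"
    unfolding E using K by (cases "Suc p = t") (auto simp: field_simps)
  finally show ?thesis by (simp add: A_def B_def n)
qed

text \<open>Let m = K - t > p + 1. Before the correction for p + 1 = t, the clique count exceeds the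
  claim by at most \<open>K\<close>. Merging saves \<open>K\<close> if p + 1 < t; if p + 1 = t it
  saves K (m - t + 1) / 2, which also covers the correction K (m - t - 1) / 2.\<close>

lemma plan_within_rate:
  assumes pt: "p < t" and tp: "t + p < K"
  shows "\<exists>\<X> D. delivery_plan K t p \<X> \<and> card \<X> \<le> D \<and>
    cw_map_rate (int K) (int t) (int p) = real D / real (K * ((K - t) choose p))"
proof (cases "K = t + p + 1")
  case True
  obtain \<X> where "delivery_plan K t p \<X>" "card \<X> \<le> Suc p" using single_clique_plan[OF True] by blast
  moreover have "Suc p \<le> (if Suc p = t then (p + 1)^2 else p + 1)" by (simp add: power2_eq_square)
  ultimately show ?thesis using rate_single[OF True pt] by (meson order_trans)
next
  case False
  define m where "m = K - t"
  have K: "K = t + m" and m: "p + 2 \<le> m" using False tp by (auto simp: m_def)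
  obtain n where n: "m = Suc (Suc n)" "p \<le> n"
    using m by (metis add_2_eq_Suc add_le_cancel_left le_Suc_ex add.commute add.left_commute le_add1)
  define A where "A = (Suc n choose Suc p)"
  define B where "B = (n choose p)"
  have bound: "m choose Suc p \<le> A + p * B + 1"
    using binomial_Suc_le'[OF n(2)] by (simp add: A_def B_def n)
  have rate: "cw_map_rate (int K) (int t) (int p) = real K * (real A + real p * real B
      - of_bool (Suc p = t) * (real m - real t - 1) / 2) / real (K * ((K - t) choose p))"
    using rate_general[OF K pt m] by (simp add: A_def B_def n)
  show ?thesis
  proof (cases "Suc p = t")
    case True
    obtain s where s: "m = t + Suc s" using True m by (metis add_2_eq_Suc' add_Suc_right add_Suc le_Suc_ex)
    \<comment> \<open>All distances with p < \<delta> < K - p are used; they are at least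
      \<open>t\<close>, so \<open>max t\<close> fixes them.\<close>
    have "\<exists>\<X>. delivery_plan K t p \<X> \<and> 2 * card \<X> + K * card {t..K - t} \<le> 2 * (K * ((K - t) choose Suc p))"
      by (rule merged_plan[OF pt tp]) (use True s K in \<open>auto simp: inj_on_def max_def\<close>)
    then obtain \<X> where X: "delivery_plan K t p \<X>"
      "2 * card \<X> + K * card {t..K - t} \<le> 2 * (K * ((K - t) choose Suc p))" by blast
    have "card {t..K - t} = s + 2" using K s by simp
    then have "2 * card \<X> + K * (s + 2) \<le> 2 * (K * (m choose Suc p))" using X(2) by (simp add: m_def)
    also have "\<dots> \<le> 2 * (K * (A + p * B + 1))" using bound by (intro mult_le_mono2)
    finally have le: "2 * card \<X> + K * s \<le> 2 * (K * (A + p * B))" by (simp add: algebra_simps)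
    \<comment> \<open>K = 2 t + s + 1, so \<open>K\<close> and \<open>s\<close> have opposite
      parity.\<close>
    have "even (K * s)" using K s by (cases "even s") auto
    then obtain h where h: "K * s = 2 * h" by blast
    have "card \<X> \<le> K * (A + p * B) - h" "h \<le> K * (A + p * B)" using le h by linarith+
    moreover have "real K * (real A + real p * real B - of_bool (Suc p = t) * (real m - real t - 1) / 2)
      = real (K * (A + p * B) - h)"
    proof -
      have "real K * real s = 2 * real h" using h by (metis of_nat_mult of_nat_numeral)
      then show ?thesis using True s \<open>h \<le> K * (A + p * B)\<close> by (simp add: of_nat_diff field_simps)
    qed
    ultimately show ?thesis using X(1) rate by metis
  next
    case False
    \<comment> \<open>Two mirrored distances suffice; \<open>max t\<close> sends them to t and to K
      - p - 1 > t.\<close>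
    let ?\<Delta> = "{Suc p, K - Suc p}"
    have "\<exists>\<X>. delivery_plan K t p \<X> \<and> 2 * card \<X> + K * card ?\<Delta> \<le> 2 * (K * ((K - t) choose Suc p))"
      by (rule merged_plan[OF pt tp]) (use False K m pt in \<open>auto simp: inj_on_def max_def\<close>)
    then obtain \<X> where X: "delivery_plan K t p \<X>"
      "2 * card \<X> + K * card ?\<Delta> \<le> 2 * (K * ((K - t) choose Suc p))" by blast
    have "Suc p \<noteq> K - Suc p" using K m pt by simp
    then have "card \<X> + K \<le> K * (m choose Suc p)" using X(2) by (simp add: m_def)
    also have "\<dots> \<le> K * (A + p * B + 1)" using bound by (rule mult_le_mono2)
    finally have "card \<X> \<le> K * (A + p * B)" by simp
    moreover have "cw_map_rate (int K) (int t) (int p) =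
        real (K * (A + p * B)) / real (K * ((K - t) choose p))"
      using rate False by simp
    ultimately show ?thesis using X(1) by blast
  qed
qed

theorem theorem2:
  fixes K L N :: nat and Ma Mp :: real and \<gamma>a \<gamma>p :: int
  assumes "1 \<le> L" and "L \<le> K" and "K \<le> N"
    and "0 \<le> Ma" and "Ma \<le> real N" and "0 \<le> Mp" and "Mp \<le> real N"
    and "0 < Ma * real L + Mp" and "Ma * real L + Mp < real N"
    and "real_of_int \<gamma>a = real K * Ma / real N" and "0 \<le> \<gamma>a" and "\<gamma>a \<le> int K"
    and "real_of_int \<gamma>p = real K * Mp / real N" and "0 \<le> \<gamma>p" and "\<gamma>p < \<gamma>a * int L"
  shows "achievable_uncoded K L Ma Mp N
           (cw_map_rate (int K) (\<gamma>a * int L) \<gamma>p)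
           (K * ibinom (int K - \<gamma>a * int L) \<gamma>p)"
proof -
  obtain a p where a: "\<gamma>a = int a" and p: "\<gamma>p = int p"
    using \<open>0 \<le> \<gamma>a\<close> \<open>0 \<le> \<gamma>p\<close> nonneg_int_cases by metis
  have pos: "0 < real N" "0 < real K" using assms(1-3) by auto
  have Ma: "real a * real N = Ma * real K" and Mp: "real p * real N = Mp * real K"
    using assms(10,13) pos by (auto simp: a p field_simps)
  \<comment> \<open>Scaled by K / N, the strict memory bound becomes a L + p < K, so at least p + 1
    users cannot read a given subfile.\<close>
  have "(real a * real L + real p) * real N = (Ma * real L + Mp) * real K"
    using Ma Mp by (simp add: algebra_simps)
  also have "\<dots> < real N * real K" using assms(9) pos by simp
  finally have "real (a * L + p) < real K" using pos by (simp add: mult.commute)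
  then have tp: "a * L + p < K" by (simp only: of_nat_less_iff)
  have pt: "p < a * L" using assms(15) by (simp add: a p flip: of_nat_mult)
  obtain \<X> D where "delivery_plan K (a * L) p \<X>" "card \<X> \<le> D"
    and rate: "cw_map_rate (int K) (int (a * L)) (int p) = real D / real (K * ((K - a * L) choose p))"
    using plan_within_rate[OF pt tp] by blast
  then have "achievable_uncoded K L Ma Mp N (real D / real (K * ((K - a * L) choose p)))
      (K * ((K - a * L) choose p))"
    using achievable_by_plan assms(1,3) tp Ma Mp by simp
  moreover have "ibinom (int K - int (a * L)) (int p) = (K - a * L) choose p"
    using tp ibinom_of_nat[of "K - a * L" p] by (simp add: of_nat_diff)
  ultimately show ?thesis unfolding a p rate[symmetric] by (simp only: of_nat_mult)
qed

end
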